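(* Let $T$ be a tree of order at least $3$. If $\Delta(T)$ is odd and $T$ is not $(3^p-2)$-regular for any integer $p\geq 2$, then $\chi'_g(T)\leq\Delta(T)+2$; otherwise $\chi'_g(T)\leq\Delta(T)+3$.
   Context: For an integer $r\geq 2$, a tree is $r$-regular if each of its non-leaf vertices has degree $r$. For an Abelian group $\mathcal{G}$ (written additively), a $\mathcal{G}$-twin edge coloring of a graph $G$ is a proper edge labeling $f:E(G)\to\mathcal{G}$ (adjacent edges receive distinct labels) such that the weighted degrees $w(v)=\sum_{u\in N(v)}f(uv)$ satisfy $w(u)\neq w(v)$ for every edge $uv$. The group twin chromatic index $\chi'_g(G)$ is the least integer $k\geq 2$ such that $G$ has a $\mathcal{G}$-twin edge coloring for every Abelian group $\mathcal{G}$ of order $k$. $\Delta(T)$ is the maximum degree. *)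

theory Defs
  imports
    "Graph_Theory.Graph_Theory"
    "HOL-Algebra.Group"
    "HOL-Algebra.FiniteProduct"
    "HOL-Algebra.Coset"
    "HOL-Library.Extended_Nat"
begin

(* Finite simple graphs are the symmetric, loop-free, finite pair digraphs (locale pair_graph);
   an undirected edge is represented by both of its arcs (u,v) and (v,u), and written {u,v}. *)

definition edges :: "'a pair_pre_digraph \<Rightarrow> 'a set set" where
  "edges G = {{u, v} | u v. (u, v) \<in> parcs G}"

definition neighbors :: "'a pair_pre_digraph \<Rightarrow> 'a \<Rightarrow> 'a set" where
  "neighbors G v = {u. (v, u) \<in> parcs G}"

(* In a symmetric digraph the number of arcs leaving v is the undirected degree of v. *)
abbreviation vdegree :: "'a pair_pre_digraph \<Rightarrow> 'a \<Rightarrow> nat" where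
  "vdegree G v \<equiv> out_degree (with_proj G) v"

definition max_degree :: "'a pair_pre_digraph \<Rightarrow> nat" where
  "max_degree G = Max (vdegree G ` pverts G)"

(* Digraph_Component.tree is not usable for symmetric digraphs: there the closed walk u, v, u along
   a single edge counts as a cycle. The cycles of an undirected simple graph are exactly those of
   length at least 3. *)
definition undirected_tree :: "'a pair_pre_digraph \<Rightarrow> bool" where
  "undirected_tree G \<longleftrightarrow>
     pair_graph G \<and> connected (with_proj G) \<and>
     \<not> (\<exists>p. pre_digraph.cycle (with_proj G) p \<and> 3 \<le> length p)"

definition regular_tree :: "nat \<Rightarrow> 'a pair_pre_digraph \<Rightarrow> bool" where
  "regular_tree r T \<longleftrightarrow>
     2 \<le> r \<and> undirected_tree T \<and> (\<forall>v \<in> pverts T. vdegree T v \<noteq> 1 \<longrightarrow> vdegree T v = r)"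

(* HOL-Algebra groups are written multiplicatively, so the sum over N(v) is a finprod. *)
definition weighted_degree ::
  "('g, 'm) monoid_scheme \<Rightarrow> 'a pair_pre_digraph \<Rightarrow> ('a set \<Rightarrow> 'g) \<Rightarrow> 'a \<Rightarrow> 'g" where
  "weighted_degree A G f v = finprod A (\<lambda>u. f {u, v}) (neighbors G v)"

definition proper_edge_labeling ::
  "('g, 'm) monoid_scheme \<Rightarrow> 'a pair_pre_digraph \<Rightarrow> ('a set \<Rightarrow> 'g) \<Rightarrow> bool" where
  "proper_edge_labeling A G f \<longleftrightarrow>
     (\<forall>e \<in> edges G. f e \<in> carrier A) \<and>
     (\<forall>e \<in> edges G. \<forall>e' \<in> edges G. e \<noteq> e' \<and> e \<inter> e' \<noteq> {} \<longrightarrow> f e \<noteq> f e')"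

definition twin_edge_coloring ::
  "('g, 'm) monoid_scheme \<Rightarrow> 'a pair_pre_digraph \<Rightarrow> ('a set \<Rightarrow> 'g) \<Rightarrow> bool" where
  "twin_edge_coloring A G f \<longleftrightarrow>
     proper_edge_labeling A G f \<and>
     (\<forall>u v. {u, v} \<in> edges G \<longrightarrow> weighted_degree A G f u \<noteq> weighted_degree A G f v)"

(* A definition cannot quantify over the type of group elements. Every finite group is isomorphic
   to one whose elements are natural numbers, so it suffices to let A range over those; see
   twin_colorable_all_groups below. *)
definition twin_colorable :: "'a pair_pre_digraph \<Rightarrow> nat \<Rightarrow> bool" where
  "twin_colorable G k \<longleftrightarrow>
     (\<forall>A :: nat monoid. comm_group A \<and> order A = k \<longrightarrow> (\<exists>f. twin_edge_coloring A G f))"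

(* The infimum is a minimum when some admissible k exists, and \<infinity> otherwise; a finite
   upper bound therefore asserts existence as well. *)
definition group_twin_chromatic_index :: "'a pair_pre_digraph \<Rightarrow> enat" where
  "group_twin_chromatic_index G = Inf {enat k | k. 2 \<le> k \<and> twin_colorable G k}"

lemma twin_edge_coloring_iso:
  assumes G: "pair_graph G" and A: "comm_group A" and B: "comm_group B"
    and h: "h \<in> iso A B" and f: "twin_edge_coloring A G f"
  shows "twin_edge_coloring B G (h \<circ> f)"
proof -
  interpret G: pair_graph G by fact
  interpret A: comm_group A by fact
  interpret B: comm_group B by fact
  have hom: "h \<in> hom A B" and inj: "inj_on h (carrier A)"
    using h by (auto simp: iso_def bij_betw_def)
  have hc: "h x \<in> carrier B" if "x \<in> carrier A" for x
    using hom that by (auto simp: hom_def)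
  have fc: "f e \<in> carrier A" if "e \<in> edges G" for e
    using f that by (auto simp: twin_edge_coloring_def proper_edge_labeling_def)
  have nb: "{u, v} \<in> edges G" if "u \<in> neighbors G v" for u v
    using that unfolding neighbors_def edges_def by (auto simp: insert_commute)
  have wc: "weighted_degree A G f v \<in> carrier A" for v
    unfolding weighted_degree_def by (rule A.finprod_closed) (auto intro: fc nb)
  have hprod: "h (finprod A g S) = finprod B (\<lambda>x. h (g x)) S"
    if "finite S" "\<forall>x\<in>S. g x \<in> carrier A" for g and S :: "'a set"
    using that
  proof (induction S rule: finite_induct)
    case empty
    show ?case using hom_one[OF hom A.is_group B.is_group] by simp
  next
    case (insert x S)
    have gS: "g \<in> S \<rightarrow> carrier A" and gx: "g x \<in> carrier A"
      and hS: "(\<lambda>x. h (g x)) \<in> S \<rightarrow> carrier B" and hx: "h (g x) \<in> carrier B"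
      using insert.prems hc by auto
    have "h (finprod A g (insert x S)) = h (g x \<otimes>\<^bsub>A\<^esub> finprod A g S)"
      by (simp add: A.finprod_insert insert.hyps gS gx)
    also have "\<dots> = h (g x) \<otimes>\<^bsub>B\<^esub> h (finprod A g S)"
      by (rule hom_mult[OF hom gx A.finprod_closed[OF gS]])
    also have "\<dots> = finprod B (\<lambda>x. h (g x)) (insert x S)"
      using insert by (simp add: B.finprod_insert hS hx)
    finally show ?case .
  qed
  have fin: "finite (neighbors G v)" for v
  proof (rule finite_subset)
    show "neighbors G v \<subseteq> snd ` parcs G" by (force simp: neighbors_def)
  qed simp
  have w: "weighted_degree B G (h \<circ> f) v = h (weighted_degree A G f v)" for v
    unfolding weighted_degree_def using hprod[OF fin, of v "\<lambda>u. f {u, v}"] fc nb by simp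
  show ?thesis
    using f fc hc wc inj unfolding twin_edge_coloring_def proper_edge_labeling_def w
    by (auto simp: inj_on_eq_iff)
qed

lemma nat_copy_of_finite_comm_group:
  assumes B: "comm_group (B :: ('g, 'm) monoid_scheme)" and fin: "finite (carrier B)"
  obtains A :: "nat monoid" and h
  where "comm_group A" "order A = order B" "h \<in> iso A B"
proof -
  interpret B: comm_group B by fact
  obtain h where h: "bij_betw h {0..<card (carrier B)} (carrier B)"
    using ex_bij_betw_nat_finite[OF fin] by blast
  define N where "N = {0..<card (carrier B)}"
  define g where "g = inv_into N h"
  define A :: "nat monoid" where
    "A = \<lparr>carrier = N, mult = (\<lambda>x y. g (h x \<otimes>\<^bsub>B\<^esub> h y)), one = g \<one>\<^bsub>B\<^esub>\<rparr>"
  have hN: "bij_betw h N (carrier B)" using h by (simp add: N_def)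
  have hg: "h (g y) = y" if "y \<in> carrier B" for y
    unfolding g_def using hN that by (rule bij_betw_inv_into_right)
  have gh: "g (h x) = x" if "x \<in> N" for x
    unfolding g_def using hN that by (rule bij_betw_inv_into_left)
  have hc: "h x \<in> carrier B" if "x \<in> N" for x using hN that by (auto simp: bij_betw_def)
  have gc: "g y \<in> N" if "y \<in> carrier B" for y
    unfolding g_def using hN that by (auto simp: bij_betw_def inv_into_into)
  have "comm_group A"
  proof (rule comm_groupI)
    fix x assume x: "x \<in> carrier A"
    have "g (inv\<^bsub>B\<^esub> h x) \<in> carrier A" "g (inv\<^bsub>B\<^esub> h x) \<otimes>\<^bsub>A\<^esub> x = \<one>\<^bsub>A\<^esub>"
      using x by (simp_all add: A_def gc hc hg)
    then show "\<exists>y\<in>carrier A. y \<otimes>\<^bsub>A\<^esub> x = \<one>\<^bsub>A\<^esub>" by blast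
  qed (simp_all add: A_def gc hc hg gh B.m_ac)
  moreover have "order A = order B"
    using bij_betw_same_card[OF hN] by (simp add: order_def A_def)
  moreover have "h \<in> iso A B"
    using hN by (auto simp: iso_def hom_def A_def hc hg)
  ultimately show ?thesis using that by blast
qed

lemma twin_colorable_all_groups:
  fixes B :: "('g, 'm) monoid_scheme"
  assumes G: "pair_graph G" and k: "0 < k" and col: "twin_colorable G k"
    and B: "comm_group B" and ord: "order B = k"
  shows "\<exists>f. twin_edge_coloring B G f"
proof -
  have "finite (carrier B)" using k ord by (auto simp: order_def intro: card_ge_0_finite)
  then obtain A :: "nat monoid" and h
    where A: "comm_group A" "order A = order B" and h: "h \<in> iso A B"
    using nat_copy_of_finite_comm_group[OF B] by blast
  obtain f where "twin_edge_coloring A G f"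
    using col A ord by (auto simp: twin_colorable_def)
  from twin_edge_coloring_iso[OF G A(1) B h this] show ?thesis by blast
qed

end

theory Submission
  imports Defs "HOL-Algebra.Multiplicative_Group" "HOL-Algebra.Sylow"
begin

text \<open>
  Colour the tree outwards from a root \<open>r\<close>, fixing all edges at a vertex at once; write the group
  multiplicatively. Throughout, the weight \<open>w(u)\<close> of a treated vertex differs from the labels of the
  edges leading away from the root. If \<open>v\<close> is reached by an edge labelled \<open>c\<close>, its other edges
  therefore only need distinct labels other than \<open>c\<close> whose product is \<open>1\<close>: then \<open>w(v) = c\<close>, which
  differs from \<open>w(u)\<close> and from the new labels. In a group of odd order such sets are unions of
  pairs \<open>{x, x\<^sup>-\<^sup>1}\<close>, with one triple added when the size is odd. Only size \<open>1\<close> would force the label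
  \<open>1\<close>; there any \<open>x \<notin> {1, c, c\<^sup>-\<^sup>1 w(u)}\<close> works as long as \<open>c \<noteq> 1\<close>, so the label \<open>1\<close> is never used.

  The root needs labels whose product is not among them. For \<open>\<Delta>\<close> even take groups of order
  \<open>\<Delta> + 3\<close>. For \<open>\<Delta>\<close> odd and order \<open>\<Delta> + 2\<close>, use a non-leaf of degree less than \<open>\<Delta>\<close> as root; if there is
  none, the tree is regular, the label \<open>1\<close> is harmless, and the root gets all labels except \<open>x\<close> and
  \<open>x\<^sup>-\<^sup>2\<close> for some \<open>x\<close> with \<open>x\<^sup>3 \<noteq> 1\<close>, which exists unless \<open>\<Delta> + 2\<close> is a power of \<open>3\<close>. In the remaining
  case the order is \<open>\<Delta> + 3 = 3\<^sup>p + 1\<close>, which is even but not a power of \<open>2\<close>, and the label sets are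
  complements of sets of three or four elements with the same product as the whole group.
\<close>

section \<open>Greedy colourings of trees\<close>

lemma (in comm_monoid) finprod_inj_image:
  assumes "inj_on g N" "g ` N = S" "S \<subseteq> carrier G"
  shows "(\<Otimes>x\<in>N. g x) = (\<Otimes>x\<in>S. x)"
  using finprod_reindex[of "\<lambda>x. x" g N] assms by (simp add: subset_iff)

section \<open>Walks and neighbourhoods in undirected graphs\<close>

lemma pcas_snoc: "pcas u (p @ [(a, b)]) c \<longleftrightarrow> pcas u p a \<and> c = b"
  by (induction p arbitrary: u) auto

lemma pawalk_verts_snoc: "pcas u p a \<Longrightarrow> pawalk_verts u (p @ [(a, b)]) = pawalk_verts u p @ [b]"
  by (induction p arbitrary: u) auto

lemma neighbors_sym:
  assumes "pair_graph G"
  shows "u \<in> neighbors G v \<longleftrightarrow> v \<in> neighbors G u"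
proof -
  interpret G: pair_graph G by fact
  show ?thesis
    using G.pair_sym_arcs by (auto simp: neighbors_def symmetric_def sym_def)
qed

lemma neighbors_irrefl: "pair_graph G \<Longrightarrow> v \<notin> neighbors G v"
  using pair_loopfree_digraph.pair_no_loops[of G "(v, v)"]
  by (auto simp: neighbors_def pair_graph_def pair_digraph_def)

lemma finite_neighbors:
  assumes "pair_graph G"
  shows "finite (neighbors G v)"
proof -
  interpret G: pair_graph G by fact
  have "neighbors G v \<subseteq> snd ` parcs G" by (force simp: neighbors_def)
  then show ?thesis by (rule finite_subset) simp
qed

lemma neighbors_in_pverts:
  assumes "pair_graph G" "u \<in> neighbors G v"
  shows "u \<in> pverts G" "v \<in> pverts G"
proof -
  interpret G: pair_graph G by fact
  show "u \<in> pverts G" "v \<in> pverts G"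
    using assms(2) G.in_arcsD1 G.in_arcsD2 by (auto simp: neighbors_def)
qed

lemma vdegree_eq_card_neighbors: "vdegree G v = card (neighbors G v)"
proof -
  have "out_arcs (with_proj G) v = Pair v ` neighbors G v"
    by (auto simp: out_arcs_def neighbors_def)
  then show ?thesis
    by (simp add: out_degree_def card_image inj_on_def)
qed

lemma in_edges_iff:
  assumes "pair_graph G"
  shows "{u, v} \<in> edges G \<longleftrightarrow> u \<in> neighbors G v"
  using neighbors_sym[OF assms, of u v]
  by (auto simp: edges_def neighbors_def doubleton_eq_iff)

section \<open>Growing a tree vertex by vertex, and vertex degrees\<close>

text \<open>Take a largest vertex set that contains \<open>r\<close>, satisfies \<open>P\<close> and
  in which any two vertices are joined by a path inside the set. If a vertex is missing,
  connectivity gives an edge leaving the set; a second neighbour of its outer end inside the set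
  would close a cycle, so the set could be enlarged.\<close>

lemma undirected_tree_induct [consumes 2, case_names root grow]:
  assumes T: "undirected_tree T" and r: "r \<in> pverts T"
    and root: "P {r}"
    and grow: "\<And>U u v. \<lbrakk>U \<subseteq> pverts T; P U; u \<in> U; v \<in> pverts T - U; neighbors T v \<inter> U = {u}\<rbrakk>
                 \<Longrightarrow> P (insert v U)"
  shows "P (pverts T)"
proof -
  have pg: "pair_graph T" using T by (simp add: undirected_tree_def)
  interpret T: pair_graph T by fact
  define joined where "joined U a b \<longleftrightarrow> (\<exists>p. set p \<subseteq> parcs T \<and> pcas a p b \<and>
      distinct (pawalk_verts a p) \<and> set (pawalk_verts a p) \<subseteq> U)" for U a b
  define good where "good U \<longleftrightarrow> r \<in> U \<and> U \<subseteq> pverts T \<and> P U \<and> (\<forall>a\<in>U. \<forall>b\<in>U. joined U a b)" for U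
  have "good {r}"
    using r root by (auto simp: good_def joined_def intro!: exI[of _ "[]"])
  moreover have "good U \<longrightarrow> card U \<le> card (pverts T)" for U
    by (simp add: good_def card_mono T.pair_finite_verts)
  ultimately obtain U where U: "good U" and max: "\<And>W. good W \<Longrightarrow> card W \<le> card U"
    using ex_has_greatest_nat[of good "{r}" card "Suc (card (pverts T))"]
    by (metis le_imp_less_Suc less_or_eq_imp_le)
  have UV: "U \<subseteq> pverts T" and PU: "P U" and rU: "r \<in> U" using U by (auto simp: good_def)
  have jU: "joined U a b" if "a \<in> U" "b \<in> U" for a b using U that by (simp add: good_def)
  have "U = pverts T"
  proof (rule ccontr)
    assume "U \<noteq> pverts T"
    then obtain x where x: "x \<in> pverts T - U" using UV by blast
    \<comment> \<open>Connectedness refers to the symmetric closure, which adds no arcs to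
      \<open>T\<close>.\<close>
    have "parcs (mk_symmetric (with_proj T)) = parcs T"
      using T.pair_sym_arcs by (auto simp: parcs_mk_symmetric symmetric_def sym_def)
    moreover have "r \<rightarrow>\<^sup>*\<^bsub>with_proj (mk_symmetric (with_proj T))\<^esub> x"
      using T r x by (auto simp: undirected_tree_def connected_def strongly_connected_def)
    ultimately have "(r, x) \<in> (parcs T)\<^sup>*"
      using reachable_rtranclI by fastforce
    then have "\<exists>u v. u \<in> U \<and> v \<notin> U \<and> (u, v) \<in> parcs T"
      using rU DiffD2[OF x] by (induction rule: rtrancl_induct) auto
    then obtain u v where uv: "u \<in> U" "v \<notin> U" "(u, v) \<in> parcs T" by blast
    have vu: "(v, u) \<in> parcs T" and vV: "v \<in> pverts T - U"
      using uv T.pair_sym_arcs T.in_arcsD2 by (auto simp: symmetric_def sym_def)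
    have unique: "y = u" if y: "y \<in> neighbors T v" "y \<in> U" for y
    proof (rule ccontr)
      assume "y \<noteq> u"
      obtain p where p: "set p \<subseteq> parcs T" "pcas u p y" "distinct (pawalk_verts u p)"
        "set (pawalk_verts u p) \<subseteq> U"
        using jU[OF uv(1) y(2)] unfolding joined_def by (elim exE conjE)
      have yv: "(y, v) \<in> parcs T" using y neighbors_sym[OF pg] by (simp add: neighbors_def)
      let ?c = "(v, u) # p @ [(y, v)]"
      \<comment> \<open>The path from \<open>u\<close> to \<open>y\<close> has at least one arc, so
        the closed walk through \<open>v\<close> has length at least 3 and is not just an edge
        traversed back and forth.\<close>
      have "p \<noteq> []" using \<open>y \<noteq> u\<close> p(2) by auto
      then have "3 \<le> length ?c" by (cases p) auto
      moreover have "T.cycle ?c"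
        unfolding T.cycle_def T.awalk_def
      proof (intro exI[of _ v] conjI)
        show "pcas v ?c v" using pcas_snoc p(2) by (metis fst_conv snd_conv pcas.simps(2))
        show "distinct (tl (pawalk_verts v ?c))"
          using pawalk_verts_snoc[OF p(2)] p(3,4) uv(2) by auto
      qed (use p vu yv vV in auto)
      ultimately show False using T by (auto simp: undirected_tree_def)
    qed
    have "u \<in> neighbors T v" using vu by (simp add: neighbors_def)
    then have nbU: "neighbors T v \<inter> U = {u}" using unique uv(1) by blast
    have P': "P (insert v U)" by (rule grow[OF UV PU uv(1) vV nbU])
    have "joined (insert v U) a b" if "a \<in> insert v U" "b \<in> insert v U" for a b
    proof -
      have inU: "joined (insert v U) a b" if "joined U a b" for a b
        using that unfolding joined_def by (elim exE conjE) (intro exI conjI subset_insertI2)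
      have 1: "joined (insert v U) v b" if b: "b \<in> U" for b
      proof -
        obtain p where "set p \<subseteq> parcs T" "pcas u p b" "distinct (pawalk_verts u p)"
          "set (pawalk_verts u p) \<subseteq> U"
          using jU[OF uv(1) b] unfolding joined_def by (elim exE conjE)
        then show ?thesis unfolding joined_def
          using vu uv(2) by (auto intro!: exI[of _ "(v, u) # p"])
      qed
      have 2: "joined (insert v U) a v" if a: "a \<in> U" for a
      proof -
        obtain p where "set p \<subseteq> parcs T" "pcas a p u" "distinct (pawalk_verts a p)"
          "set (pawalk_verts a p) \<subseteq> U"
          using jU[OF a uv(1)] unfolding joined_def by (elim exE conjE)
        then show ?thesis unfolding joined_def
          using uv pcas_snoc[of a p u v v] pawalk_verts_snoc[of a p u v]
          by (intro exI[of _ "p @ [(u, v)]"]) auto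
      qed
      have 3: "joined (insert v U) v v"
        unfolding joined_def by (auto intro!: exI[of _ "[]"])
      show ?thesis using that 1 2 3 inU[OF jU] by blast
    qed
    then have "good (insert v U)" using U P' vV by (auto simp: good_def)
    then have "card (insert v U) \<le> card U" by (rule max)
    moreover have "finite U" using UV T.pair_finite_verts finite_subset by blast
    ultimately show False using uv(2) by simp
  qed
  with PU show ?thesis by simp
qed

text \<open>When the tree is grown from \<open>v\<close>, the first vertex attached is a neighbour
  of \<open>v\<close>.\<close>

lemma undirected_tree_degree_pos:
  assumes T: "undirected_tree T" and card: "2 \<le> card (pverts T)" and v: "v \<in> pverts T"
  shows "1 \<le> vdegree T v"
proof -
  have pg: "pair_graph T" using T by (simp add: undirected_tree_def)
  have "pverts T = {v} \<or> neighbors T v \<noteq> {}"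
    using T v
  proof (induction rule: undirected_tree_induct)
    case (grow U u w)
    have "w \<in> neighbors T u" using grow neighbors_sym[OF pg] by blast
    then show ?case using grow by auto
  qed simp
  with card have "neighbors T v \<noteq> {}" by auto
  then show ?thesis
    using finite_neighbors[OF pg] by (simp add: vdegree_eq_card_neighbors card_gt_0_iff Suc_le_eq)
qed

text \<open>If all degrees were at most 1, growth from \<open>r\<close> would stop after one
  attached vertex \<open>x\<close>, because \<open>r\<close> and \<open>x\<close> have no neighbours
  but each other.\<close>

lemma undirected_tree_ex_degree_ge_2:
  assumes T: "undirected_tree T" and card: "3 \<le> card (pverts T)"
  shows "\<exists>v\<in>pverts T. 2 \<le> vdegree T v"
proof (rule ccontr)
  assume "\<not> ?thesis"
  then have small: "card (neighbors T v) \<le> 1" if "v \<in> pverts T" for v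
    using that by (force simp: vdegree_eq_card_neighbors)
  have pg: "pair_graph T" using T by (simp add: undirected_tree_def)
  have eq: "a = b" if "a \<in> neighbors T v" "b \<in> neighbors T v" for a b v
    using small[OF neighbors_in_pverts(2)[OF pg that(1)]] that finite_neighbors[OF pg, of v]
    by (auto simp: card_le_Suc0_iff_eq)
  obtain r where r: "r \<in> pverts T" using card by fastforce
  have "pverts T = {r} \<or> (\<exists>x. pverts T = {r, x} \<and> x \<in> neighbors T r)"
    using T r
  proof (induction rule: undirected_tree_induct)
    case (grow U u v)
    have vu: "v \<in> neighbors T u" using grow neighbors_sym[OF pg] by blast
    from \<open>U = {r} \<or> _\<close> show ?case
    proof (elim disjE exE conjE)
      assume "U = {r}"
      then show ?case using vu grow by auto
    next
      fix x assume x: "U = {r, x}" "x \<in> neighbors T r"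
      then have "r \<in> neighbors T x" using neighbors_sym[OF pg] by blast
      have "u = r \<or> u = x" using \<open>u \<in> U\<close> x by blast
      then have "v = x \<or> v = r" using vu x \<open>r \<in> neighbors T x\<close> eq by blast
      with \<open>v \<in> pverts T - U\<close> x show ?case by blast
    qed
  qed simp
  with card show False by (auto simp: card_insert_if split: if_splits)
qed

section \<open>The greedy colouring\<close>

text \<open>This reduces colouring to choosing subsets of the group. In \<open>step\<close>, the
  vertex \<open>v\<close> is entered by an edge labelled \<open>c\<close> from a treated vertex of
  weight \<open>w\<close>, and \<open>S\<close> holds the labels of its other edges, so
  \<open>c\<close> times the product of \<open>S\<close> is the weight of \<open>v\<close>. The last
  condition on \<open>S\<close> restores the hypothesis \<open>w \<noteq> c\<close> for the vertices
  reached from \<open>v\<close>.\<close>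

lemma twin_edge_coloring_greedy:
  fixes A (structure)
  assumes T: "undirected_tree T" and r: "r \<in> pverts T" and A: "comm_group A" and L: "L \<subseteq> carrier A"
    and root: "\<exists>S\<subseteq>L. finite S \<and> card S = vdegree T r \<and> (\<Otimes>x\<in>S. x) \<notin> S"
    and step: "\<And>v c w. \<lbrakk>v \<in> pverts T; c \<in> L; w \<in> carrier A; w \<noteq> c\<rbrakk> \<Longrightarrow>
      \<exists>S\<subseteq>L - {c}. finite S \<and> card S = vdegree T v - 1 \<and>
        c \<otimes> (\<Otimes>x\<in>S. x) \<noteq> w \<and> c \<otimes> (\<Otimes>x\<in>S. x) \<notin> S"
  shows "\<exists>f. twin_edge_coloring A T f"
proof -
  interpret A: comm_group A by fact
  have pg: "pair_graph T" using T by (simp add: undirected_tree_def)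
  note fin = finite_neighbors[OF pg] and sym = neighbors_sym[OF pg]
  \<comment> \<open>All edges at a treated vertex are labelled, also those leaving \<open>U\<close>.
    The weight at the outer end of such an edge is still open, so its label is compared with the
    weight at the inner end instead.\<close>
  define ok where "ok f U \<longleftrightarrow> (\<forall>u\<in>U. inj_on (\<lambda>x. f {x, u}) (neighbors T u) \<and>
      (\<forall>x\<in>neighbors T u. f {x, u} \<in> L \<and>
         (if x \<in> U then weighted_degree A T f x \<noteq> weighted_degree A T f u
          else f {x, u} \<noteq> weighted_degree A T f u)))" for f U
  have "\<exists>f. ok f (pverts T)"
    using T r
  proof (induction rule: undirected_tree_induct)
    case root
    obtain S where S: "S \<subseteq> L" "finite S" "card S = card (neighbors T r)" "(\<Otimes>x\<in>S. x) \<notin> S"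
      using assms(5) by (auto simp: vdegree_eq_card_neighbors)
    obtain g where g: "bij_betw g (neighbors T r) S"
      using finite_same_card_bij[OF fin S(2)] S(3) by metis
    \<comment> \<open>An edge at \<open>r\<close> is identified by its other end, which turns
      \<open>g\<close> into a labelling of edges.\<close>
    define f where "f e = g (THE x. e = {x, r})" for e
    have f: "f {x, r} = g x" for x
      unfolding f_def by (rule arg_cong[of _ _ g], rule the_equality) (auto simp: doubleton_eq_iff)
    have gS: "g ` neighbors T r = S" and inj: "inj_on g (neighbors T r)"
      using g by (auto simp: bij_betw_def)
    have gL: "g x \<in> S" "g x \<in> L" if "x \<in> neighbors T r" for x using gS S(1) that by auto
    have "weighted_degree A T f r = (\<Otimes>x\<in>neighbors T r. g x)"
      by (simp add: weighted_degree_def f)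
    also have "\<dots> = (\<Otimes>x\<in>S. x)"
      using A.finprod_inj_image[OF inj gS] S(1) L by blast
    finally have w: "weighted_degree A T f r = (\<Otimes>x\<in>S. x)" .
    have "ok f {r}"
      unfolding ok_def
    proof (intro ballI conjI)
      fix y x assume y: "y \<in> {r}" and x: "x \<in> neighbors T y"
      show "f {x, y} \<in> L" using x y f gL(2) by simp
      have "g x \<noteq> (\<Otimes>x\<in>S. x)" using x y gL(1)[of x] S(4) by auto
      moreover have "x \<noteq> r" using x y neighbors_irrefl[OF pg] by auto
      ultimately show "if x \<in> {r} then weighted_degree A T f x \<noteq> weighted_degree A T f y
            else f {x, y} \<noteq> weighted_degree A T f y"
        using y f w by simp
    qed (use inj f in simp)
    then show ?case by blast
  next
    case (grow U u v)
    obtain f where f: "ok f U" using \<open>\<exists>f. ok f U\<close> by (elim exE)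
    have uU: "u \<in> U" and vU: "v \<notin> U" and vV: "v \<in> pverts T"
      and nbU: "neighbors T v \<inter> U = {u}"
      using \<open>u \<in> U\<close> \<open>v \<in> pverts T - U\<close> \<open>neighbors T v \<inter> U = {u}\<close> by auto
    then have u: "u \<in> neighbors T v" by blast
    then have vu: "v \<in> neighbors T u" using sym by blast
    have only_u: "y = u" if "y \<in> U" "y \<in> neighbors T v" for y
      using nbU that by blast
    have "f {v, u} \<in> L" "weighted_degree A T f u \<noteq> f {v, u}"
      using f vu uU vU by (force simp: ok_def)+
    moreover have "weighted_degree A T f u \<in> carrier A"
      unfolding weighted_degree_def
      by (rule A.finprod_closed) (use f uU L in \<open>auto simp: ok_def\<close>)
    ultimately obtain S where S: "S \<subseteq> L - {f {v, u}}" "finite S" "card S = card (neighbors T v) - 1"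
      "f {v, u} \<otimes> (\<Otimes>x\<in>S. x) \<noteq> weighted_degree A T f u" "f {v, u} \<otimes> (\<Otimes>x\<in>S. x) \<notin> S"
      using step[of v "f {v, u}" "weighted_degree A T f u"] vV
      by (auto simp: vdegree_eq_card_neighbors)
    have "card (neighbors T v - {u}) = card S" using S(3) u fin by simp
    then obtain g where g: "bij_betw g (neighbors T v - {u}) S"
      using finite_same_card_bij[of "neighbors T v - {u}" S] fin S(2) by auto
    have gS: "g ` (neighbors T v - {u}) = S" and inj: "inj_on g (neighbors T v - {u})"
      using g by (auto simp: bij_betw_def)
    \<comment> \<open>Among the edges, only those at \<open>v\<close> other than {v, u} are
      relabelled. They lead out of \<open>U\<close>, as \<open>u\<close> is the only treated
      neighbour of \<open>v\<close>; labels and weights at treated vertices therefore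
      survive.\<close>
    define f' where "f' e = (if v \<in> e \<and> e \<noteq> {v, u} then g (THE x. e = {x, v}) else f e)" for e
    have the: "(THE x. {y, v} = {x, v}) = y" for y
      by (rule the_equality) (auto simp: doubleton_eq_iff)
    have f'v: "f' {x, v} = g x" if "x \<noteq> u" for x
      using that the by (auto simp: f'_def doubleton_eq_iff)
    have f'u: "f' {u, v} = f {v, u}" by (simp add: f'_def insert_commute)
    have f'U: "f' {x, y} = f {x, y}" if "y \<in> U" "x \<in> neighbors T y" for x y
    proof (cases "x = v")
      case True
      then have "y = u" using only_u that sym by blast
      then show ?thesis using True by (simp add: f'_def)
    next
      case False
      then show ?thesis using that vU by (auto simp: f'_def)
    qed
    have wU: "weighted_degree A T f' y = weighted_degree A T f y" if y: "y \<in> U" for y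
      unfolding weighted_degree_def
    proof (rule A.finprod_cong')
      show "(\<lambda>x. f {x, y}) \<in> neighbors T y \<rightarrow> carrier A"
        using f L y by (auto simp: ok_def)
    qed (use f'U y in auto)
    have gL: "g x \<in> S" "g x \<in> L" "g x \<noteq> f {v, u}" if "x \<in> neighbors T v" "x \<noteq> u" for x
      using gS S(1) that by auto
    have gA: "g x \<in> carrier A" if "x \<in> neighbors T v - {u}" for x
      using gL(2)[of x] that L by blast
    have cA: "f {v, u} \<in> carrier A" using \<open>f {v, u} \<in> L\<close> L by blast
    have "weighted_degree A T f' v = (\<Otimes>x\<in>insert u (neighbors T v - {u}). f' {x, v})"
      using u by (simp add: weighted_degree_def insert_absorb)
    also have "\<dots> = f {v, u} \<otimes> (\<Otimes>x\<in>neighbors T v - {u}. f' {x, v})"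
      by (subst A.finprod_insert) (use fin[of v] gA f'v f'u cA in auto)
    also have "(\<Otimes>x\<in>neighbors T v - {u}. f' {x, v}) = (\<Otimes>x\<in>neighbors T v - {u}. g x)"
      by (rule A.finprod_cong') (use gA f'v in auto)
    also have "\<dots> = (\<Otimes>x\<in>S. x)"
      using A.finprod_inj_image[OF inj gS] S(1) L by blast
    finally have wv: "weighted_degree A T f' v = f {v, u} \<otimes> (\<Otimes>x\<in>S. x)" .
    have "ok f' (insert v U)"
      unfolding ok_def
    proof (intro ballI conjI)
      fix y assume y: "y \<in> insert v U"
      show "inj_on (\<lambda>x. f' {x, y}) (neighbors T y)"
      proof (cases "y = v")
        case True
        have "inj_on (\<lambda>x. f' {x, v}) (neighbors T v - {u})"
          using inj f'v by (simp add: inj_on_def)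
        moreover have "f' {u, v} \<notin> (\<lambda>x. f' {x, v}) ` (neighbors T v - {u})"
          using f'u f'v gL(3) by force
        ultimately have "inj_on (\<lambda>x. f' {x, v}) (insert u (neighbors T v - {u}))"
          by (simp only: inj_on_insert Diff_idemp simp_thms)
        then show ?thesis using True u by (simp only: insert_Diff)
      next
        case False
        then have yU: "y \<in> U" using y by blast
        then have "inj_on (\<lambda>x. f {x, y}) (neighbors T y)" using f by (simp add: ok_def)
        then show ?thesis using f'U[OF yU] by (simp add: inj_on_def)
      qed
      fix x assume x: "x \<in> neighbors T y"
      show "f' {x, y} \<in> L"
      proof (cases "y = v")
        case True
        then show ?thesis using x f'v f'u gL(2) \<open>f {v, u} \<in> L\<close> by (cases "x = u") simp_all
      next
        case False
        then have yU: "y \<in> U" using y by blast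
        then have "f {x, y} \<in> L" using f x by (simp add: ok_def)
        then show ?thesis using f'U[OF yU x] by simp
      qed
      show "if x \<in> insert v U then weighted_degree A T f' x \<noteq> weighted_degree A T f' y
            else f' {x, y} \<noteq> weighted_degree A T f' y"
      proof (cases "y = v")
        case True
        show ?thesis
        proof (cases "x = u")
          case x': True
          then show ?thesis using True uU S(4) by (auto simp: wv wU)
        next
          case False
          then have "x \<notin> insert v U" using only_u x True neighbors_irrefl[OF pg, of v] by blast
          moreover have "g x \<in> S" using gL(1) False True x by blast
          ultimately show ?thesis using False True f'v[of x] S(5) wv by auto
        qed
      next
        case False
        then have yU: "y \<in> U" using y by blast
        show ?thesis
        proof (cases "x = v")
          case True
          then have "y = u" using only_u x yU sym by blast
          then show ?thesis using True uU S(4) by (auto simp: wv wU)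
        next
          case False
          have "if x \<in> U then weighted_degree A T f x \<noteq> weighted_degree A T f y
            else f {x, y} \<noteq> weighted_degree A T f y"
            using f x yU by (simp add: ok_def)
          then show ?thesis using False f'U[OF yU x] wU[of x] wU[OF yU] by simp
        qed
      qed
    qed
    then show ?case by blast
  qed
  then obtain f where f: "ok f (pverts T)" by blast
  have nb: "\<exists>y. e = {y, x} \<and> y \<in> neighbors T x" if "e \<in> edges T" "x \<in> e" for e x
  proof -
    obtain a b where e: "e = {a, b}" "b \<in> neighbors T a"
      using \<open>e \<in> edges T\<close> by (auto simp: edges_def neighbors_def)
    then have "a \<in> neighbors T b" using sym by blast
    then show ?thesis using e that(2) by (auto simp: insert_commute)
  qed
  have "twin_edge_coloring A T f"
    unfolding twin_edge_coloring_def proper_edge_labeling_def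
  proof (intro conjI ballI allI impI)
    fix e assume e: "e \<in> edges T"
    then obtain x where "x \<in> e" by (auto simp: edges_def)
    then obtain y where "e = {y, x}" "y \<in> neighbors T x" using nb e by blast
    then show "f e \<in> carrier A"
      using f L neighbors_in_pverts[OF pg] by (auto simp: ok_def)
  next
    fix e e' assume e: "e \<in> edges T" "e' \<in> edges T" "e \<noteq> e' \<and> e \<inter> e' \<noteq> {}"
    then obtain x where "x \<in> e" "x \<in> e'" by blast
    then obtain y y' where y: "e = {y, x}" "y \<in> neighbors T x" "e' = {y', x}" "y' \<in> neighbors T x"
      using nb e by meson
    then have "inj_on (\<lambda>x'. f {x', x}) (neighbors T x)"
      using f neighbors_in_pverts[OF pg] by (auto simp: ok_def)
    then show "f e \<noteq> f e'" using y e(3) by (auto dest: inj_onD)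
  next
    fix a b assume "{a, b} \<in> edges T"
    then have "a \<in> neighbors T b" using in_edges_iff[OF pg] by blast
    then show "weighted_degree A T f a \<noteq> weighted_degree A T f b"
      using f neighbors_in_pverts[OF pg] by (auto simp: ok_def)
  qed
  then show ?thesis by blast
qed

section \<open>Subsets of a finite abelian group with product one\<close>

context comm_group
begin

text \<open>Replaces the search for a large set with product 1 by that for a small complement with
  the product of the whole group.\<close>

lemma finprod_carrier_Diff:
  assumes "finite (carrier G)" "X \<subseteq> carrier G"
  shows "(\<Otimes>x\<in>carrier G - X. x) = (\<Otimes>x\<in>carrier G. x) \<otimes> inv (\<Otimes>x\<in>X. x)"
proof -
  have X: "(\<Otimes>x\<in>X. x) \<in> carrier G" using assms(2) by (intro finprod_closed) auto
  have D: "(\<Otimes>x\<in>carrier G - X. x) \<in> carrier G" by (intro finprod_closed) auto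
  have "(\<Otimes>x\<in>(carrier G - X) \<union> X. x) = (\<Otimes>x\<in>carrier G - X. x) \<otimes> (\<Otimes>x\<in>X. x)"
    using assms finite_subset by (intro finprod_Un_disjoint) auto
  moreover have "(carrier G - X) \<union> X = carrier G" using assms(2) by blast
  ultimately show ?thesis using X D by (simp add: m_assoc)
qed

text \<open>Pairs of mutually inverse elements are added one at a time, each contributing the
  product 1.\<close>

lemma ex_inv_closed_subset:
  assumes X: "finite X" "X \<subseteq> carrier G" "\<And>x. x \<in> X \<Longrightarrow> inv x \<in> X" "\<And>x. x \<in> X \<Longrightarrow> inv x \<noteq> x"
  shows "2 * j \<le> card X \<Longrightarrow>
    \<exists>S\<subseteq>X. (\<forall>x\<in>S. inv x \<in> S) \<and> card S = 2 * j \<and> (\<Otimes>x\<in>S. x) = \<one>"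
proof (induction j)
  case 0
  show ?case by (intro exI[of _ "{}"]) auto
next
  case (Suc j)
  then obtain S where S: "S \<subseteq> X" "\<forall>x\<in>S. inv x \<in> S" "card S = 2 * j" "(\<Otimes>x\<in>S. x) = \<one>"
    by auto
  have finS: "finite S" and SG: "S \<subseteq> carrier G" using S(1) X finite_subset by auto
  have "S \<noteq> X" using S(3) Suc.prems by auto
  then obtain x where x: "x \<in> X" "x \<notin> S" using S(1) by blast
  have xG: "x \<in> carrier G" using x X by blast
  \<comment> \<open>Closure of \<open>S\<close> under inverses ensures that the partner of a new
    element is new as well.\<close>
  have ix: "inv x \<notin> S" using S(2) x xG by force
  have "(\<Otimes>y\<in>insert x (insert (inv x) S). y) = x \<otimes> (inv x \<otimes> \<one>)"
    using finS SG x xG ix X(4)[OF x(1)] S(4) by (simp add: Pi_iff subset_iff)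
  also have "\<dots> = \<one>" using xG by simp
  finally have "(\<Otimes>y\<in>insert x (insert (inv x) S). y) = \<one>" .
  moreover have "card (insert x (insert (inv x) S)) = 2 * Suc j"
    using finS x ix X(4)[OF x(1)] S(3) by simp
  ultimately show ?case
    using S(1,2) x X(3) xG by (intro exI[of _ "insert x (insert (inv x) S)"]) auto
qed

lemma nat_pow_2: "x \<in> carrier G \<Longrightarrow> x [^] (2::nat) = x \<otimes> x"
  by (simp add: numeral_2_eq_2)

section \<open>Groups of odd order\<close>

lemma odd_order_square_eq_one:
  assumes "odd (order G)" "x \<in> carrier G" "x \<otimes> x = \<one>"
  shows "x = \<one>"
proof -
  obtain k where k: "order G = Suc (2 * k)" using assms(1) by (auto elim: oddE)
  have "x [^] (2 * k) = (x [^] (2::nat)) [^] k" using assms(2) by (simp add: nat_pow_pow)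
  also have "x [^] (2::nat) = \<one>" using assms(2,3) by (simp add: nat_pow_2)
  finally have "x [^] order G = x" using assms(2) by (simp add: k)
  then show ?thesis using pow_order_eq_1[OF assms(2)] by simp
qed

lemma odd_order_inv_neq:
  assumes "odd (order G)" "x \<in> carrier G" "x \<noteq> \<one>"
  shows "inv x \<noteq> x"
  using assms odd_order_square_eq_one[of x] r_inv[of x] by metis

lemma odd_order_finprod_carrier:
  assumes odd: "odd (order G)"
  shows "(\<Otimes>x\<in>carrier G. x) = \<one>"
proof -
  have fin: "finite (carrier G)" using odd by (metis card.infinite even_zero order_def)
  let ?X = "carrier G - {\<one>}"
  have cX: "card ?X = order G - 1" using fin by (simp add: order_def)
  then have "2 * (card ?X div 2) = card ?X" using odd by simp
  then obtain S where S: "S \<subseteq> ?X" "card S = card ?X" "(\<Otimes>x\<in>S. x) = \<one>"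
    using ex_inv_closed_subset[of ?X "card ?X div 2"] fin odd_order_inv_neq[OF odd] by auto
  then have "S = ?X" using fin by (intro card_subset_eq) auto
  then have "(\<Otimes>x\<in>insert \<one> ?X. x) = \<one>"
    using fin S(3) by (subst finprod_insert) auto
  then show ?thesis by (simp add: insert_absorb)
qed

text \<open>Deleting 1, \<open>c\<close> and the inverse of \<open>c\<close> leaves at least
  \<open>m\<close> elements, which form inverse pairs. The case c = 1 is included, as the regular
  trees require.\<close>

lemma odd_order_ex_even_subset:
  assumes odd: "odd (order G)" and c: "c \<in> carrier G" and m: "even m" "m + 3 \<le> order G"
  shows "\<exists>S\<subseteq>carrier G - {\<one>, c}. card S = m \<and> (\<Otimes>x\<in>S. x) = \<one>"
proof -
  have fin: "finite (carrier G)" using odd by (metis card.infinite even_zero order_def)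
  let ?X = "carrier G - {\<one>, c, inv c}"
  have "card (carrier G) - card {\<one>, c, inv c} \<le> card ?X" by (rule diff_card_le_card_Diff) simp
  moreover have "card {\<one>, c, inv c} \<le> 3" by (simp add: card_insert_if)
  ultimately have "2 * (m div 2) \<le> card ?X" using m by (simp add: order_def)
  moreover have "inv x \<in> ?X" if "x \<in> ?X" for x
    using that c by (auto simp: inv_eq_1_iff)
  ultimately obtain S where "S \<subseteq> ?X" "card S = 2 * (m div 2)" "(\<Otimes>x\<in>S. x) = \<one>"
    using ex_inv_closed_subset[of ?X "m div 2"] fin odd_order_inv_neq[OF odd] by auto
  then show ?thesis using m(1) by (intro exI[of _ S]) auto
qed

text \<open>Inverse pairs are combined with one triple c^-1, a, b where a b = c. Since the triple
  uses c^-1, whose partner is forbidden anyway, the pairs have to avoid at most the seven elements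
  of \<open>?Y\<close>; the bound on \<open>m\<close> leaves just enough room for the other
  \<open>m - 3\<close> elements.\<close>

lemma odd_order_ex_odd_subset:
  assumes odd: "odd (order G)" and c: "c \<in> carrier G" "c \<noteq> \<one>"
    and m: "odd m" "3 \<le> m" "m + 4 \<le> order G"
  shows "\<exists>S\<subseteq>carrier G - {\<one>, c}. card S = m \<and> (\<Otimes>x\<in>S. x) = \<one>"
proof -
  have fin: "finite (carrier G)" using odd by (metis card.infinite even_zero order_def)
  \<comment> \<open>Squaring is injective in odd order, so \<open>?sq\<close> has at most one
    element. Hence at most five elements are excluded for \<open>a\<close>, in a group of order at
    least 7.\<close>
  let ?sq = "{a \<in> carrier G. a \<otimes> a = c}"
  have sq: "a = b" if "a \<in> ?sq" "b \<in> ?sq" for a b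
  proof -
    have G: "a \<in> carrier G" "b \<in> carrier G" and e: "a \<otimes> a = b \<otimes> b" using that by auto
    have "(a \<otimes> inv b) \<otimes> (a \<otimes> inv b) = (a \<otimes> a) \<otimes> inv (b \<otimes> b)"
      using G by (simp add: inv_mult m_ac)
    also have "\<dots> = \<one>" unfolding e using G by (intro r_inv) simp
    finally have "a \<otimes> inv b = \<one>" 
      using odd_order_square_eq_one[OF odd, of "a \<otimes> inv b"] G by blast
    then show ?thesis using G by (metis inv_closed inv_equality inv_inv)
  qed
  have "card ?sq \<le> 1"
    unfolding One_nat_def by (intro card_le_Suc0_iff_eq[THEN iffD2] ballI sq) (simp add: fin)
  moreover have "card {\<one>, c, inv c, c \<otimes> c} \<le> 4" by (simp add: card_insert_if)
  ultimately have "card ({\<one>, c, inv c, c \<otimes> c} \<union> ?sq) \<le> 5"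
    using card_Un_le[of "{\<one>, c, inv c, c \<otimes> c}" ?sq] by linarith
  also have "5 < card (carrier G)" using m by (simp add: order_def)
  finally have "\<not> carrier G \<subseteq> {\<one>, c, inv c, c \<otimes> c} \<union> ?sq"
    using card_mono[of "{\<one>, c, inv c, c \<otimes> c} \<union> ?sq" "carrier G"] fin by auto
  \<comment> \<open>For b = c a^-1 the last five conditions give in turn b \<noteq> c, b \<noteq> 1,
    a \<noteq> c^-1, b \<noteq> c^-1 and b \<noteq> a.\<close>
  then obtain a where a: "a \<in> carrier G" "a \<noteq> \<one>" "a \<noteq> c" "a \<noteq> inv c" "a \<noteq> c \<otimes> c" "a \<otimes> a \<noteq> c"
    by blast
  define b where "b = c \<otimes> inv a"
  have b: "b \<in> carrier G" and ab: "a \<otimes> b = c" using a(1) c by (simp_all add: b_def m_lcomm[of a])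
  have b': "b \<noteq> \<one>" "b \<noteq> c" "b \<noteq> a" "b \<noteq> inv a"
    using a ab c by auto
  have "a = c \<otimes> inv b" using inv_solve_right'[of a c b] a(1) b c ab by simp
  then have b'': "b \<noteq> inv c" using a(5) c by auto
  let ?Y = "{\<one>, c, inv c, a, inv a, b, inv b}"
  let ?X = "carrier G - ?Y"
  have "card (carrier G) - card ?Y \<le> card ?X" by (rule diff_card_le_card_Diff) simp
  moreover have "card ?Y \<le> 7"
    using card_length[of "[\<one>, c, inv c, a, inv a, b, inv b]"] by simp
  ultimately have "2 * ((m - 3) div 2) \<le> card ?X" using m by (simp add: order_def)
  moreover have "inv x \<in> ?X" if x: "x \<in> ?X" for x
  proof -
    have "inv (inv x) = x" using x by simp
    moreover have "inv u \<in> ?Y" if "u \<in> ?Y" for u using that a(1) b c by auto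
    ultimately have "inv x \<notin> ?Y" using x by (metis DiffD2)
    then show ?thesis using x by simp
  qed
  ultimately obtain S where S: "S \<subseteq> ?X" "card S = 2 * ((m - 3) div 2)" "(\<Otimes>x\<in>S. x) = \<one>"
    using ex_inv_closed_subset[of ?X "(m - 3) div 2"] fin odd_order_inv_neq[OF odd] by auto
  have finS: "finite S" and SG: "S \<subseteq> carrier G" using S(1) fin finite_subset by auto
  let ?S = "insert (inv c) (insert a (insert b S))"
  have notin: "inv c \<notin> insert a (insert b S)" "a \<notin> insert b S" "b \<notin> S" using S(1) a b' b'' by auto
  have "(\<Otimes>x\<in>?S. x) = inv c \<otimes> (a \<otimes> (b \<otimes> \<one>))"
    using finS SG notin a(1) b c S(3) by (simp add: Pi_iff subset_iff)
  also have "\<dots> = \<one>" using b c ab by simp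
  finally have "(\<Otimes>x\<in>?S. x) = \<one>" .
  moreover have "card ?S = m" using finS notin S(2) m by simp
  moreover have "?S \<subseteq> carrier G - {\<one>, c}"
    using S(1) a b b' c odd_order_inv_neq[OF odd c] by auto
  ultimately show ?thesis by blast
qed

lemma odd_order_ex_subset:
  assumes odd: "odd (order G)" and c: "c \<in> carrier G" "c \<noteq> \<one>" and m: "2 \<le> m" "m + 3 \<le> order G"
  shows "\<exists>S\<subseteq>carrier G - {\<one>, c}. card S = m \<and> (\<Otimes>x\<in>S. x) = \<one>"
proof (cases "even m")
  case True
  then show ?thesis using odd_order_ex_even_subset odd c m by blast
next
  case False
  then have "3 \<le> m" using m(1) by (cases "m = 2") auto
  \<comment> \<open>Here \<open>m + 3\<close> is even and the order is odd, so the inequality is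
    strict.\<close>
  moreover have "m + 4 \<le> order G" using False odd m(2) by presburger
  ultimately show ?thesis using odd_order_ex_odd_subset[OF odd c False] by blast
qed

text \<open>Cauchy's theorem: Sylow's theorem with exponent 1 provides a subgroup of order
  \<open>p\<close>, and each of its elements other than 1 will do.\<close>

lemma ex_prime_order_element:
  assumes fin: "finite (carrier G)" and p: "prime p" "p dvd order G"
  shows "\<exists>x\<in>carrier G. x \<noteq> \<one> \<and> x [^] p = \<one>"
proof -
  obtain m where "order G = p ^ 1 * m" using p(2) by auto
  then obtain H where H: "subgroup H G" "card H = p ^ 1"
    using sylow_thm[OF p(1) is_group _ fin, of 1 m] by auto
  have "\<not> H \<subseteq> {\<one>}"
    using H(2) card_mono[of "{\<one>}" H] prime_gt_1_nat[OF p(1)] by auto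
  then obtain x where x: "x \<in> H" "x \<noteq> \<one>" by blast
  interpret H: group "G\<lparr>carrier := H\<rparr>" using H(1) by (rule subgroup.subgroup_is_group) simp
  have "x [^]\<^bsub>G\<lparr>carrier := H\<rparr>\<^esub> order (G\<lparr>carrier := H\<rparr>) = \<one>"
    using H.pow_order_eq_1[of x] x by simp
  then have "x [^] p = \<one>" using H(2) by (simp add: order_def nat_pow_consistent[symmetric])
  then show ?thesis using x H(1) subgroup.subset by blast
qed

text \<open>Another prime divisor of the order would yield, by Cauchy's theorem, a nontrivial
  element whose order divides two distinct primes. The contrapositive for the primes 2 and 3
  supplies elements with x^2 \<noteq> 1 and x^3 \<noteq> 1.\<close>

lemma exponent_prime_imp_order_prime_power:
  assumes fin: "finite (carrier G)" and q: "prime q" and exp: "\<And>x. x \<in> carrier G \<Longrightarrow> x [^] q = \<one>"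
  shows "\<exists>k. order G = q ^ k"
proof -
  have "order G \<noteq> 0" using fin order_gt_0_iff_finite by simp
  then obtain m where m: "order G = q ^ multiplicity q (order G) * m" "\<not> q dvd m"
    using multiplicity_decompose'[of "order G" q] q by (metis not_prime_unit)
  have "m = 1"
  proof (rule ccontr)
    assume "m \<noteq> 1"
    then obtain p where p: "prime p" "p dvd m" using prime_factor_nat by blast
    then have "p \<noteq> q" using m(2) by blast
    have "p dvd order G" using p(2) by (subst m(1)) simp
    then obtain x where x: "x \<in> carrier G" "x \<noteq> \<one>" "x [^] p = \<one>"
      using ex_prime_order_element[OF fin p(1)] by blast
    then have "ord x dvd p" "ord x dvd q" using exp pow_eq_id by auto
    then have "ord x = 1" using \<open>p \<noteq> q\<close> p(1) q
      by (metis gcd_greatest_iff primes_coprime coprime_imp_gcd_eq_1 nat_dvd_1_iff_1)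
    then show False using x ord_eq_1 by simp
  qed
  then show ?thesis using m(1) by auto
qed

section \<open>Complements of three and four elements\<close>

text \<open>\<open>S\<close> is the complement of four elements c, x, y, z whose product is the
  product \<open>s\<close> of the whole group. The value e = y z is fixed first: as a non-square it
  forces y \<noteq> z, and e \<noteq> s c^-2 forces x \<noteq> c.\<close>

lemma even_order_ex_subset:
  assumes fin: "finite (carrier G)" and n: "even (order G)" "5 \<le> order G" and c: "c \<in> carrier G"
  shows "\<exists>S\<subseteq>carrier G - {c}. card S = order G - 4 \<and> (\<Otimes>x\<in>S. x) = \<one>"
proof -
  define s where "s = (\<Otimes>x\<in>carrier G. x)"
  have s: "s \<in> carrier G" unfolding s_def by (intro finprod_closed) auto
  define sq where "sq x = x \<otimes> x" for x
  obtain t where t: "t \<in> carrier G" "t \<noteq> \<one>" "sq t = \<one>"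
    using ex_prime_order_element[OF fin, of 2] n(1) nat_pow_2 by (auto simp: sq_def)
  \<comment> \<open>Squaring identifies \<open>t\<close> with 1, so on a finite group it is not
    surjective and non-squares exist.\<close>
  then have "\<not> inj_on sq (carrier G)"
    using inj_onD[of sq "carrier G" t \<one>] by (auto simp: sq_def)
  then have "sq ` carrier G \<noteq> carrier G" using eq_card_imp_inj_on[OF fin, of sq] by auto
  moreover have "sq ` carrier G \<subseteq> carrier G" by (auto simp: sq_def)
  ultimately obtain g where g: "g \<in> carrier G" "g \<notin> sq ` carrier G" by blast
  \<comment> \<open>If 1 is the only square, any element besides 1 and s c^-2 serves. Otherwise
    \<open>g\<close> and g x^2 are distinct non-squares for some \<open>x\<close>, and one of them
    differs from s c^-2.\<close>
  obtain e where e: "e \<in> carrier G" "e \<notin> sq ` carrier G" "e \<noteq> s \<otimes> inv (sq c)"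
  proof (cases "\<forall>x\<in>carrier G. sq x = \<one>")
    case True
    have "\<not> carrier G \<subseteq> {\<one>, s \<otimes> inv (sq c)}"
      using card_mono[of "{\<one>, s \<otimes> inv (sq c)}" "carrier G"] n(2)
      by (auto simp: order_def card_insert_if split: if_splits)
    then show ?thesis using True that by blast
  next
    case False
    then obtain x where x: "x \<in> carrier G" "sq x \<noteq> \<one>" by blast
    have "g \<otimes> sq x \<noteq> sq y" if "y \<in> carrier G" for y
    proof
      assume "g \<otimes> sq x = sq y"
      then have "g = sq y \<otimes> inv (sq x)"
        using inv_solve_right'[of g "sq y" "sq x"] g(1) x(1) that by (simp add: sq_def)
      also have "\<dots> = sq (y \<otimes> inv x)" using that x(1) by (simp add: sq_def inv_mult m_ac)
      finally show False using g(2) that x(1) by blast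
    qed
    then have "g \<otimes> sq x \<notin> sq ` carrier G" by blast
    moreover have "g \<otimes> sq x \<noteq> g" using g(1) x by (simp add: sq_def)
    ultimately show ?thesis using that g x(1) by (metis m_closed sq_def)
  qed
  define x where "x = s \<otimes> inv c \<otimes> inv e"
  have x: "x \<in> carrier G" using s c e by (simp add: x_def)
  have "x \<otimes> e = s \<otimes> inv c" using s c e(1) by (simp add: x_def m_assoc)
  then have cxe: "c \<otimes> x \<otimes> e = s" using s c e(1) x by (simp add: m_assoc m_lcomm[of c])
  have "x \<noteq> c"
  proof
    assume "x = c"
    then have "e \<otimes> sq c = s" using cxe c e(1) by (simp add: sq_def m_ac)
    then show False using e(1,3) s c inv_solve_right'[of e s "sq c"] by (simp add: sq_def)
  qed
  \<comment> \<open>These are the values of \<open>y\<close> for which \<open>y\<close> or z = e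
    y^-1 equals \<open>c\<close> or \<open>x\<close>.\<close>
  have "card {c, x, e \<otimes> inv c, e \<otimes> inv x} < card (carrier G)"
    using n(2) by (simp add: order_def card_insert_if)
  then have "\<not> carrier G \<subseteq> {c, x, e \<otimes> inv c, e \<otimes> inv x}"
    using card_mono[of "{c, x, e \<otimes> inv c, e \<otimes> inv x}" "carrier G"] by auto
  then obtain y where y: "y \<in> carrier G" "y \<noteq> c" "y \<noteq> x" "y \<noteq> e \<otimes> inv c" "y \<noteq> e \<otimes> inv x"
    by blast
  define z where "z = e \<otimes> inv y"
  have z: "z \<in> carrier G" and yz: "y \<otimes> z = e" using e(1) y(1) by (simp_all add: z_def m_lcomm)
  have "y = e \<otimes> inv z" using inv_solve_right'[of y e z] z yz y(1) e(1) by simp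
  then have z': "z \<noteq> c" "z \<noteq> x" "z \<noteq> y" using y e(2) yz by (auto simp: sq_def)
  have "(\<Otimes>u\<in>{c, x, y, z}. u) = s"
    using c x y z z' \<open>x \<noteq> c\<close> cxe yz e(1) by (simp add: m_assoc)
  then have "(\<Otimes>u\<in>carrier G - {c, x, y, z}. u) = \<one>"
    using finprod_carrier_Diff[OF fin, of "{c, x, y, z}"] c x y z s by (simp add: s_def)
  moreover have "card (carrier G - {c, x, y, z}) = order G - 4"
    using fin c x y z z' \<open>x \<noteq> c\<close> by (subst card_Diff_subset) (auto simp: order_def)
  ultimately show ?thesis by (intro exI[of _ "carrier G - {c, x, y, z}"]) auto
qed

text \<open>The complement is {1, y, z} with y z = s, so \<open>y\<close> must avoid 1,
  \<open>s\<close> and the square roots of \<open>s\<close>. Translation by \<open>a\<close> carries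
  roots to non-roots; the roots thus fill at most half of the group.\<close>

lemma ex_nonunit_subset:
  assumes fin: "finite (carrier G)" and n: "5 \<le> order G" and a: "a \<in> carrier G" "a \<otimes> a \<noteq> \<one>"
  shows "\<exists>S\<subseteq>carrier G - {\<one>}. card S = order G - 3 \<and> (\<Otimes>x\<in>S. x) = \<one>"
proof -
  define s where "s = (\<Otimes>x\<in>carrier G. x)"
  have s: "s \<in> carrier G" unfolding s_def by (intro finprod_closed) auto
  let ?B = "{y \<in> carrier G. y \<otimes> y = s}"
  have "(\<lambda>y. y \<otimes> a) ` ?B \<subseteq> carrier G - ?B"
  proof (intro image_subsetI DiffI notI)
    fix y assume "y \<in> ?B"
    then have y: "y \<in> carrier G" "y \<otimes> y = s" by auto
    show "y \<otimes> a \<in> carrier G" using y a by simp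
    assume "y \<otimes> a \<in> ?B"
    then have "s \<otimes> (a \<otimes> a) = s" using y a by (auto simp: m_ac)
    then show False using s a by simp
  qed
  moreover have "inj_on (\<lambda>y. y \<otimes> a) ?B" using a by (auto simp: inj_on_def)
  ultimately have "card ?B \<le> card (carrier G - ?B)"
    using fin by (intro card_inj_on_le) auto
  also have "\<dots> = order G - card ?B" using fin by (subst card_Diff_subset) (auto simp: order_def)
  finally have "2 * card ?B \<le> order G" using n by linarith
  moreover have "card ({\<one>, s} \<union> ?B) \<le> 2 + card ?B"
    using card_Un_le[of "{\<one>, s}" ?B] by (simp add: card_insert_if split: if_splits)
  ultimately have "card ({\<one>, s} \<union> ?B) < card (carrier G)" using n by (simp add: order_def)
  then have "\<not> carrier G \<subseteq> {\<one>, s} \<union> ?B"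
    using card_mono[of "{\<one>, s} \<union> ?B" "carrier G"] fin by auto
  then obtain y where y: "y \<in> carrier G" "y \<noteq> \<one>" "y \<noteq> s" "y \<otimes> y \<noteq> s" by blast
  define z where "z = s \<otimes> inv y"
  have z: "z \<in> carrier G" and yz: "y \<otimes> z = s" using s y(1) by (simp_all add: z_def m_lcomm)
  have z': "z \<noteq> \<one>" "z \<noteq> y" using y yz by auto
  have "(\<Otimes>u\<in>{\<one>, y, z}. u) = s" using y z z' yz s by simp
  then have "(\<Otimes>u\<in>carrier G - {\<one>, y, z}. u) = \<one>"
    using finprod_carrier_Diff[OF fin, of "{\<one>, y, z}"] y z s by (simp add: s_def)
  moreover have "card (carrier G - {\<one>, y, z}) = order G - 3"
    using fin y z z' by (subst card_Diff_subset) (auto simp: order_def)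
  ultimately show ?thesis by (intro exI[of _ "carrier G - {\<one>, y, z}"]) auto
qed

end

section \<open>Twin edge colourings of trees\<close>

text \<open>The bound is stronger at \<open>r\<close> because all edges there need new labels,
  whereas any other vertex has one edge labelled already.\<close>

lemma twin_edge_coloring_odd_order:
  fixes A (structure)
  assumes T: "undirected_tree T" and A: "comm_group A" and odd: "odd (order A)" and n: "5 \<le> order A"
    and deg: "\<And>v. v \<in> pverts T \<Longrightarrow> vdegree T v + 2 \<le> order A"
    and r: "r \<in> pverts T" "2 \<le> vdegree T r" "vdegree T r + 3 \<le> order A"
  shows "\<exists>f. twin_edge_coloring A T f"
proof -
  interpret A: comm_group A by fact
  have fin: "finite (carrier A)" using odd by (metis card.infinite even_zero order_def)
  have avoid: "\<exists>x. x \<in> carrier A \<and> x \<notin> X" if "finite X" "card X \<le> 3" for X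
  proof -
    have "\<not> carrier A \<subseteq> X"
      using card_mono[of X "carrier A"] that n by (auto simp: order_def)
    then show ?thesis by blast
  qed
  show ?thesis
  proof (rule twin_edge_coloring_greedy[OF T r(1) A, of "carrier A - {\<one>}"])
    \<comment> \<open>The root has no incoming edge; any element other than 1 stands in for its
      label.\<close>
    obtain c where "c \<in> carrier A" "c \<noteq> \<one>" using avoid[of "{\<one>}"] by auto
    then obtain S where "S \<subseteq> carrier A - {\<one>, c}" "card S = vdegree T r" "(\<Otimes>x\<in>S. x) = \<one>"
      using A.odd_order_ex_subset[OF odd _ _ r(2,3)] by blast
    then show "\<exists>S\<subseteq>carrier A - {\<one>}. finite S \<and> card S = vdegree T r \<and> (\<Otimes>x\<in>S. x) \<notin> S"
      using fin finite_subset by (intro exI[of _ S]) auto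
  next
    fix v c w assume v: "v \<in> pverts T" and c: "c \<in> carrier A - {\<one>}" and w: "w \<in> carrier A" "w \<noteq> c"
    consider "vdegree T v - 1 = 0" | "vdegree T v - 1 = 1" | "2 \<le> vdegree T v - 1" by linarith
    then show "\<exists>S\<subseteq>carrier A - {\<one>} - {c}. finite S \<and> card S = vdegree T v - 1 \<and>
        c \<otimes> (\<Otimes>x\<in>S. x) \<noteq> w \<and> c \<otimes> (\<Otimes>x\<in>S. x) \<notin> S"
    proof cases
      case 1
      then show ?thesis using c w by (intro exI[of _ "{}"]) auto
    next
      case 2
      have "card {\<one>, c, inv c \<otimes> w} \<le> 3" by (simp add: card_insert_if)
      then obtain x where x: "x \<in> carrier A" "x \<notin> {\<one>, c, inv c \<otimes> w}"
        using avoid[of "{\<one>, c, inv c \<otimes> w}"] by blast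
      have "c \<otimes> x \<noteq> w" using x c w A.inv_solve_left[of x c w] by auto
      then show ?thesis using 2 x c by (intro exI[of _ "{x}"]) auto
    next
      case 3
      obtain S where "S \<subseteq> carrier A - {\<one>, c}" "card S = vdegree T v - 1" "(\<Otimes>x\<in>S. x) = \<one>"
        using A.odd_order_ex_subset[OF odd _ _ 3, of c] c deg[OF v] 3 by auto
      then show ?thesis using fin finite_subset c w by (intro exI[of _ S]) auto
    qed
  qed auto
qed

text \<open>A non-leaf other than the root needs \<open>order A - 3\<close> further labels. This
  number is even, so inverse pairs suffice even when the incoming label is 1.\<close>

lemma twin_edge_coloring_regular_odd_order:
  fixes A (structure)
  assumes T: "undirected_tree T" and A: "comm_group A" and odd: "odd (order A)"
    and deg: "\<And>v. v \<in> pverts T \<Longrightarrow> vdegree T v = 1 \<or> vdegree T v + 2 = order A"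
    and r: "r \<in> pverts T" "vdegree T r + 2 = order A"
    and x: "x \<in> carrier A" "x [^] (3::nat) \<noteq> \<one>"
  shows "\<exists>f. twin_edge_coloring A T f"
proof -
  interpret A: comm_group A by fact
  have fin: "finite (carrier A)" using odd by (metis card.infinite even_zero order_def)
  show ?thesis
  proof (rule twin_edge_coloring_greedy[OF T r(1) A, of "carrier A"])
    let ?y = "inv (x \<otimes> x)"
    have y: "?y \<in> carrier A" using x by simp
    have "x \<otimes> (x \<otimes> x) \<noteq> \<one>" using x by (simp add: numeral_3_eq_3 A.m_assoc)
    then have "x \<noteq> ?y" using x by (metis A.l_inv A.m_closed)
    have "(\<Otimes>u\<in>{x, ?y}. u) = x \<otimes> ?y" using \<open>x \<noteq> ?y\<close> x y by simp
    also have "\<dots> = inv x" using x by (simp add: A.inv_mult A.m_assoc[symmetric])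
    \<comment> \<open>The whole group has product 1, so omitting elements with product x^-1 leaves
      the product \<open>x\<close>, which is itself omitted.\<close>
    finally have "(\<Otimes>u\<in>carrier A - {x, ?y}. u) = x"
      using A.finprod_carrier_Diff[OF fin, of "{x, ?y}"] x y A.odd_order_finprod_carrier[OF odd] by simp
    moreover have "card (carrier A - {x, ?y}) = vdegree T r"
      using fin x y \<open>x \<noteq> ?y\<close> r(2) by (subst card_Diff_subset) (auto simp: order_def)
    ultimately show "\<exists>S\<subseteq>carrier A. finite S \<and> card S = vdegree T r \<and> (\<Otimes>x\<in>S. x) \<notin> S"
      using fin by (intro exI[of _ "carrier A - {x, ?y}"]) auto
  next
    fix v c w assume v: "v \<in> pverts T" and c: "c \<in> carrier A" and w: "w \<in> carrier A" "w \<noteq> c"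
    have "\<exists>S\<subseteq>carrier A - {c}. card S = vdegree T v - 1 \<and> (\<Otimes>x\<in>S. x) = \<one>"
    proof (cases "vdegree T v = 1")
      case True
      then show ?thesis by (intro exI[of _ "{}"]) auto
    next
      case False
      then have d: "vdegree T v + 2 = order A" using deg v by blast
      then have "0 < vdegree T v" using odd by presburger
      then have "even (vdegree T v - 1)" "(vdegree T v - 1) + 3 \<le> order A"
        using odd d by presburger+
      then obtain S where "S \<subseteq> carrier A - {\<one>, c}" "card S = vdegree T v - 1" "(\<Otimes>x\<in>S. x) = \<one>"
        using A.odd_order_ex_even_subset[OF odd c] by metis
      then show ?thesis by (intro exI[of _ S]) auto
    qed
    then obtain S where "S \<subseteq> carrier A - {c}" "card S = vdegree T v - 1" "(\<Otimes>x\<in>S. x) = \<one>"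
      by blast
    then show "\<exists>S\<subseteq>carrier A - {c}. finite S \<and> card S = vdegree T v - 1 \<and>
        c \<otimes> (\<Otimes>x\<in>S. x) \<noteq> w \<and> c \<otimes> (\<Otimes>x\<in>S. x) \<notin> S"
      using fin finite_subset c w by (intro exI[of _ S]) auto
  qed simp
qed

text \<open>The root takes \<open>order A - 3\<close> labels with product 1 and must avoid the label
  1. Any other non-leaf takes \<open>order A - 4\<close> further labels with product 1; its weight
  is the incoming label, so 1 may occur among them.\<close>

lemma twin_edge_coloring_regular_even_order:
  fixes A (structure)
  assumes T: "undirected_tree T" and A: "comm_group A" and even: "even (order A)" and n: "5 \<le> order A"
    and deg: "\<And>v. v \<in> pverts T \<Longrightarrow> vdegree T v = 1 \<or> vdegree T v + 3 = order A"
    and r: "r \<in> pverts T" "vdegree T r + 3 = order A"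
    and x: "x \<in> carrier A" "x \<otimes> x \<noteq> \<one>"
  shows "\<exists>f. twin_edge_coloring A T f"
proof -
  interpret A: comm_group A by fact
  have fin: "finite (carrier A)" using n A.order_gt_0_iff_finite by simp
  show ?thesis
  proof (rule twin_edge_coloring_greedy[OF T r(1) A, of "carrier A"])
    have "order A - 3 = vdegree T r" using r(2) by simp
    then obtain S where "S \<subseteq> carrier A - {\<one>}" "card S = vdegree T r" "(\<Otimes>x\<in>S. x) = \<one>"
      using A.ex_nonunit_subset[OF fin n x] by auto
    then show "\<exists>S\<subseteq>carrier A. finite S \<and> card S = vdegree T r \<and> (\<Otimes>x\<in>S. x) \<notin> S"
      using fin finite_subset by (intro exI[of _ S]) auto
  next
    fix v c w assume v: "v \<in> pverts T" and c: "c \<in> carrier A" and w: "w \<in> carrier A" "w \<noteq> c"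
    have "\<exists>S\<subseteq>carrier A - {c}. card S = vdegree T v - 1 \<and> (\<Otimes>x\<in>S. x) = \<one>"
    proof (cases "vdegree T v = 1")
      case True
      then show ?thesis by (intro exI[of _ "{}"]) auto
    next
      case False
      then have "vdegree T v - 1 = order A - 4" using deg[OF v] by linarith
      then show ?thesis using A.even_order_ex_subset[OF fin even n c] by simp
    qed
    then obtain S where "S \<subseteq> carrier A - {c}" "card S = vdegree T v - 1" "(\<Otimes>x\<in>S. x) = \<one>"
      by blast
    then show "\<exists>S\<subseteq>carrier A - {c}. finite S \<and> card S = vdegree T v - 1 \<and>
        c \<otimes> (\<Otimes>x\<in>S. x) \<noteq> w \<and> c \<otimes> (\<Otimes>x\<in>S. x) \<notin> S"
      using fin finite_subset c w by (intro exI[of _ S]) auto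
  qed simp
qed

section \<open>Choice of the group order\<close>

text \<open>Modulo 8 a power of 3 is 1 or 3, so the left side is not divisible by 8, whereas a power
  of 2 that is at least 10 is.\<close>

lemma three_power_plus_1_not_two_power:
  assumes "2 \<le> p"
  shows "(3::nat) ^ p + 1 \<noteq> 2 ^ k"
proof
  assume eq: "(3::nat) ^ p + 1 = 2 ^ k"
  have "(3::nat) ^ 2 \<le> 3 ^ p" using assms by (intro power_increasing) auto
  then have "(2::nat) ^ 3 \<le> 2 ^ k" using eq by simp
  then have "3 \<le> k" by (simp only: power_increasing_iff)
  then have "(2::nat) ^ 3 dvd 3 ^ p + 1" unfolding eq by (rule le_imp_power_dvd)
  then have "(8::nat) dvd 3 ^ p + 1" by simp
  moreover have "(3::nat) ^ p mod 8 = 1 \<or> (3::nat) ^ p mod 8 = 3"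
  proof (induction p)
    case (Suc p)
    then show ?case unfolding power_Suc by presburger
  qed simp
  ultimately show False by presburger
qed

lemma group_twin_chromatic_index_le:
  assumes "2 \<le> k" "\<And>A :: nat monoid. \<lbrakk>comm_group A; order A = k\<rbrakk> \<Longrightarrow> \<exists>f. twin_edge_coloring A T f"
  shows "group_twin_chromatic_index T \<le> enat k"
proof -
  have "twin_colorable T k" unfolding twin_colorable_def using assms(2) by blast
  then have "enat k \<in> {enat k | k. 2 \<le> k \<and> twin_colorable T k}" using assms(1) by blast
  then show ?thesis unfolding group_twin_chromatic_index_def by (rule Inf_lower)
qed

theorem theorem4:
  fixes T :: "'a pair_pre_digraph"
  assumes "undirected_tree T"
    and "3 \<le> card (pverts T)"
  shows "if odd (max_degree T) \<and> \<not> (\<exists>p\<ge>2. regular_tree (3 ^ p - 2) T)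
         then group_twin_chromatic_index T \<le> enat (max_degree T + 2)
         else group_twin_chromatic_index T \<le> enat (max_degree T + 3)"
proof -
  note T = \<open>undirected_tree T\<close>
  define D where "D = max_degree T"
  have fin: "finite (vdegree T ` pverts T)"
    using assms(2) card.infinite by (intro finite_imageI) fastforce
  have le: "vdegree T v \<le> D" if "v \<in> pverts T" for v
    unfolding D_def max_degree_def using fin that by (intro Max_ge) auto
  obtain v0 where v0: "v0 \<in> pverts T" "2 \<le> vdegree T v0"
    using undirected_tree_ex_degree_ge_2[OF assms] by blast
  have D2: "2 \<le> D" using le v0 by fastforce
  have "D \<in> vdegree T ` pverts T"
    unfolding D_def max_degree_def using fin v0 by (intro Max_in) auto
  then obtain r where r: "r \<in> pverts T" "vdegree T r = D" by auto
  have pos: "1 \<le> vdegree T v" if "v \<in> pverts T" for v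
    using undirected_tree_degree_pos[OF T _ that] assms(2) by simp
  show ?thesis
  proof (cases "odd D")
    case odd: True
    have D3: "3 \<le> D" using D2 odd by (cases "D = 2") auto
    show ?thesis
    proof (cases "\<exists>p\<ge>2. regular_tree (3 ^ p - 2) T")
      case True
      then obtain p where p: "2 \<le> p" "regular_tree (3 ^ p - 2) T" by blast
      have deg: "vdegree T v = 1 \<or> vdegree T v = 3 ^ p - 2" if "v \<in> pverts T" for v
        using p(2) that by (auto simp: regular_tree_def)
      then have D: "D = 3 ^ p - 2" using r D2 by force
      then have n: "D + 3 = 3 ^ p + 1" using D2 by linarith
      have "group_twin_chromatic_index T \<le> enat (D + 3)"
      proof (rule group_twin_chromatic_index_le)
        fix A :: "nat monoid" assume A: "comm_group A" and ord: "order A = D + 3"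
        interpret A: comm_group A by fact
        have "finite (carrier A)" using ord A.order_gt_0_iff_finite by simp
        \<comment> \<open>If all squares were 1, the order 3^p + 1 would be a power of 2.\<close>
        then obtain x where x: "x \<in> carrier A" "x [^]\<^bsub>A\<^esub> (2::nat) \<noteq> \<one>\<^bsub>A\<^esub>"
          using A.exponent_prime_imp_order_prime_power[of 2] three_power_plus_1_not_two_power[OF p(1)]
            ord n by auto
        have "vdegree T v = 1 \<or> vdegree T v + 3 = order A" if "v \<in> pverts T" for v
          using deg[OF that] D ord by auto
        then show "\<exists>f. twin_edge_coloring A T f"
          using ord odd D2 r x A.nat_pow_2
          by (intro twin_edge_coloring_regular_even_order[OF T A, of r x]) auto
      qed simp
      then show ?thesis using True by (simp add: D_def)
    next
      case False
      have "group_twin_chromatic_index T \<le> enat (D + 2)"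
      proof (rule group_twin_chromatic_index_le)
        fix A :: "nat monoid" assume A: "comm_group A" and ord: "order A = D + 2"
        interpret A: comm_group A by fact
        have finA: "finite (carrier A)" using ord A.order_gt_0_iff_finite by simp
        show "\<exists>f. twin_edge_coloring A T f"
        proof (cases "\<forall>v\<in>pverts T. vdegree T v = 1 \<or> vdegree T v = D")
          case True
          then have reg: "regular_tree D T" using D2 T by (auto simp: regular_tree_def)
          have "order A \<noteq> 3 ^ k" for k
          proof
            assume k: "order A = 3 ^ k"
            \<comment> \<open>The order is at least 5, which excludes the exponents 0 and 1; then
              \<open>T\<close> would be one of the excepted regular trees.\<close>
            have "2 \<le> k"
            proof (rule ccontr)
              assume "\<not> 2 \<le> k"
              then have "k = 0 \<or> k = 1" by linarith
              then show False using k ord D3 by auto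
            qed
            moreover have "3 ^ k - 2 = D" using k ord by simp
            ultimately show False using False reg by auto
          qed
          then obtain x where x: "x \<in> carrier A" "x [^]\<^bsub>A\<^esub> (3::nat) \<noteq> \<one>\<^bsub>A\<^esub>"
            using A.exponent_prime_imp_order_prime_power[OF finA, of 3] by auto
          show ?thesis
            by (rule twin_edge_coloring_regular_odd_order[OF T A, of r x])
              (use ord odd True r x in auto)
        next
          case False
          then obtain v where v: "v \<in> pverts T" "vdegree T v \<noteq> 1" "vdegree T v \<noteq> D" by blast
          \<comment> \<open>A non-leaf whose degree is not maximal has degree at most
            \<open>D - 1\<close>, which is what the root needs.\<close>
          have "2 \<le> vdegree T v" "vdegree T v + 3 \<le> order A"
            using pos[OF v(1)] le[OF v(1)] v ord by linarith+
          then show ?thesis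
            by (intro twin_edge_coloring_odd_order[OF T A, of v]) (use ord odd D3 le v in auto)
        qed
      qed simp
      then show ?thesis using False odd by (simp add: D_def)
    qed
  next
    case False
    \<comment> \<open>For even \<open>D\<close> the order \<open>D + 3\<close> is odd, and a vertex
      of maximum degree meets the root bound with equality.\<close>
    have "group_twin_chromatic_index T \<le> enat (D + 3)"
    proof (rule group_twin_chromatic_index_le)
      fix A :: "nat monoid" assume A: "comm_group A" and ord: "order A = D + 3"
      have "vdegree T v + 2 \<le> order A" if "v \<in> pverts T" for v
        using le[OF that] ord by simp
      then show "\<exists>f. twin_edge_coloring A T f"
        by (intro twin_edge_coloring_odd_order[OF T A, of r]) (use ord False D2 r in auto)
    qed simp
    then show ?thesis using False by (simp add: D_def)
  qed
qed

end
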